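(* Let $[T],[S]\in Q\subset\mathbb{CP}^3$ lie over different points of $S^3$. Then there exists an oriented circle in $S^3$ such that $[T]$ and $[S]$ are tangent to it in positive direction if and only if $\Omega(T,S)=0$.
   Context: Regard $\mathbb H^2$ as a right $\mathbb H$-vector space and identify $\mathbb H^2\cong\mathbb C^4$ via right multiplication by $i$, i.e. $(z_1+jz_2,z_3+jz_4)\leftrightarrow(z_1,z_2,z_3,z_4)$. The twistor projection is $\mathbb{CP}^3\to\mathbb{HP}^1$, $e\mapsto e\mathbb H$. The unit sphere $S^3\subset\mathbb H=\mathbb R^4$ is embedded in $\mathbb{HP}^1$ by $x\mapsto[x:1]$; its image is the set of isotropic lines of the indefinite form $\langle v,w\rangle=\bar v_1w_1-\bar v_2w_2$ on $\mathbb H^2$. $Q\subset\mathbb{CP}^3$ is the preimage of $S^3$ under the twistor projection, i.e. $Q=\{[z]:|z_1|^2+|z_2|^2-|z_3|^2-|z_4|^2=0\}$. $Q$ is identified with the tangent sphere bundle $SS^3$ (bundle of oriented tangent lines of $S^3$): the oriented tangent line spanned by $x\mu\in T_xS^3$, with $\mu\in\operatorname{Im}\mathbb H$, $|\mu|=1$, corresponds to the point $\{(x,1)\lambda:\lambda\in\mathbb H,\ \mu\lambda=\lambda i\}\in Q$. The complex $2$-form $\Omega$ on $\mathbb C^4$ is obtained by decomposing $\langle\cdot,\cdot\rangle$ into its $(1,i)$- and $(j,k)$-parts, $\langle z,w\rangle=(z,w)+j\,\Omega(z,w)$ with $(z,w),\Omega(z,w)\in\mathbb C$; explicitly $$\Omega(z,w)=z_1w_2-z_2w_1-z_3w_4+z_4w_3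 .$$ The condition $\Omega(T,S)=0$ does not depend on the choice of representatives $T,S\in\mathbb C^4$. An oriented circle in $S^3$ is the intersection of $S^3\subset\mathbb R^4$ with an oriented affine $2$-plane; here the intersection is a genuine circle (more than one point), oriented by the plane. That $[T]\in Q$ is tangent to the circle in positive direction means that its base point lies on the circle and $[T]$ is the positively oriented tangent line of the circle at that point. *)

theory Defs
  imports "HOL-Analysis.Analysis"
begin

text \<open>
  The pair \<open>(a, b)\<close> of complex numbers stands for the quaternion \<open>a + j b\<close>. The product type
  already carries the Euclidean structure of the four-dimensional real space, so addition, real
  scaling, norm and inner product are the library's. Multiplication follows from
  \<open>z j = j cnj z\<close> and \<open>j j = -1\<close>.
\<close>

type_synonym quat = "complex \<times> complex"

definition qmult :: "quat \<Rightarrow> quat \<Rightarrow> quat"  (infixl "\<odot>" 70)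
  where "p \<odot> q = (fst p * fst q - cnj (snd p) * snd q, cnj (fst p) * snd q + snd p * fst q)"

definition qcnj :: "quat \<Rightarrow> quat"
  where "qcnj p = (cnj (fst p), - snd p)"

definition qone :: quat where "qone = (1, 0)"
definition qi :: quat where "qi = (\<i>, 0)"
definition qj :: quat where "qj = (0, 1)"
definition qk :: quat where "qk = qi \<odot> qj"

definition qImag :: "quat set"
  where "qImag = {q. Re (fst q) = 0}"

lemma qunit_relations:
  "qi \<odot> qi = - qone" "qj \<odot> qj = - qone" "qk \<odot> qk = - qone" "qi \<odot> qj \<odot> qk = - qone"
  by (simp_all add: qmult_def qone_def qi_def qj_def qk_def)

lemma quat_decomp: "(a, b) = (a, 0) + qj \<odot> (b, 0)"
  by (simp add: qmult_def qj_def)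

lemma qmult_assoc: "p \<odot> q \<odot> r = p \<odot> (q \<odot> r)"
  by (simp add: qmult_def algebra_simps)

lemma qmult_qone [simp]: "p \<odot> qone = p" "qone \<odot> p = p"
  by (simp_all add: qmult_def qone_def)

lemma qmult_qcnj: "p \<odot> qcnj p = ((norm p)\<^sup>2) *\<^sub>R qone" "qcnj p \<odot> p = ((norm p)\<^sup>2) *\<^sub>R qone"
proof -
  have "fst p * cnj (fst p) + cnj (snd p) * snd p = complex_of_real ((norm p)\<^sup>2)"
    by (simp add: norm_prod_def complex_norm_square[symmetric] mult.commute)
  then show "p \<odot> qcnj p = ((norm p)\<^sup>2) *\<^sub>R qone" "qcnj p \<odot> p = ((norm p)\<^sup>2) *\<^sub>R qone"
    by (simp_all add: qmult_def qcnj_def qone_def scaleR_conv_of_real mult.commute)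
qed

lemma qmult_scaleR: "(c *\<^sub>R p) \<odot> q = c *\<^sub>R (p \<odot> q)" "p \<odot> (c *\<^sub>R q) = c *\<^sub>R (p \<odot> q)"
  by (simp_all add: qmult_def algebra_simps)

lemma norm_qone [simp]: "norm qone = 1"
  by (simp add: qone_def norm_Pair)

lemma norm_qmult: "norm (p \<odot> q) = norm p * norm q"
proof -
  have "(norm (p \<odot> q))\<^sup>2 = (norm p * norm q)\<^sup>2"
    by (cases p; cases q; simp add: qmult_def norm_Pair cmod_power2 power_mult_distrib)
       (simp add: power2_eq_square algebra_simps)
  then show ?thesis by simp
qed

lemma inner_qmult_qImag:
  assumes "\<mu> \<in> qImag"
  shows "x \<bullet> (x \<odot> \<mu>) = 0"
  using assms by (simp add: qImag_def qmult_def inner_prod_def inner_complex_def algebra_simps)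

text \<open>The right quaternionic vector space of pairs of quaternions.\<close>

definition hscale :: "quat \<times> quat \<Rightarrow> quat \<Rightarrow> quat \<times> quat"
  where "hscale v l = (fst v \<odot> l, snd v \<odot> l)"

definition hform :: "quat \<times> quat \<Rightarrow> quat \<times> quat \<Rightarrow> quat"
  where "hform v w = qcnj (fst v) \<odot> fst w - qcnj (snd v) \<odot> snd w"

definition hvec :: "complex^4 \<Rightarrow> quat \<times> quat"
  where "hvec z = ((z$1, z$2), (z$3, z$4))"

lemma hvec_scale: "hvec (c *s z) = hscale (hvec z) (c, 0)"
  by (simp add: hvec_def hscale_def qmult_def mult.commute)

text \<open>
  The complex two-form is the \<open>(j, k)\<close>-part of the quaternionic form, that is the
  \<open>b\<close> in \<open>a + j b\<close>.
\<close>

definition Omega :: "complex^4 \<Rightarrow> complex^4 \<Rightarrow> complex"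
  where "Omega z w = snd (hform (hvec z) (hvec w))"

lemma Omega_explicit:
  "Omega z w = z$1 * w$2 - z$2 * w$1 - z$3 * w$4 + z$4 * w$3"
  by (simp add: Omega_def hform_def hvec_def qmult_def qcnj_def)

text \<open>Points of projective spaces are the lines themselves, as sets of vectors including zero.\<close>

definition cline :: "complex^4 \<Rightarrow> (complex^4) set"
  where "cline z = {c *s z | c. True}"

definition CP3 :: "(complex^4) set set"
  where "CP3 = {cline z | z. z \<noteq> 0}"

definition hline :: "quat \<times> quat \<Rightarrow> (quat \<times> quat) set"
  where "hline v = {hscale v l | l. True}"

definition twistor :: "(complex^4) set \<Rightarrow> (quat \<times> quat) set"
  where "twistor e = {hscale (hvec z) l | z l. z \<in> e}"

definition S3 :: "quat set"
  where "S3 = sphere 0 1"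

definition S3_embed :: "quat \<Rightarrow> (quat \<times> quat) set"
  where "S3_embed x = hline (x, qone)"

definition Q :: "(complex^4) set set"
  where "Q = {e \<in> CP3. twistor e \<in> S3_embed ` S3}"

lemma mem_Q_iff:
  assumes "z \<noteq> 0"
  shows "cline z \<in> Q \<longleftrightarrow> (cmod (z$1))\<^sup>2 + (cmod (z$2))\<^sup>2 - (cmod (z$3))\<^sup>2 - (cmod (z$4))\<^sup>2 = 0"
proof -
  obtain p q where pq: "hvec z = (p, q)" by (cases "hvec z")
  have np: "(norm p)\<^sup>2 = (cmod (z$1))\<^sup>2 + (cmod (z$2))\<^sup>2"
    and nq: "(norm q)\<^sup>2 = (cmod (z$3))\<^sup>2 + (cmod (z$4))\<^sup>2"
    using pq by (auto simp: hvec_def norm_Pair)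
  have "(cmod (z$1))\<^sup>2 + (cmod (z$2))\<^sup>2 - (cmod (z$3))\<^sup>2 - (cmod (z$4))\<^sup>2 = (norm p)\<^sup>2 - (norm q)\<^sup>2"
    using np nq by simp
  also have "\<dots> = 0 \<longleftrightarrow> norm p = norm q" by simp
  finally have rhs: "?thesis \<longleftrightarrow> (cline z \<in> Q \<longleftrightarrow> norm p = norm q)" by simp
  have tw: "twistor (cline z) = hline (p, q)"
  proof
    show "twistor (cline z) \<subseteq> hline (p, q)"
    proof
      fix v assume "v \<in> twistor (cline z)"
      then obtain c l where "v = hscale (hvec (c *s z)) l" by (auto simp: twistor_def cline_def)
      then have "v = hscale (p, q) ((c, 0) \<odot> l)"
        using pq by (simp add: hvec_scale hscale_def qmult_assoc)
      then show "v \<in> hline (p, q)" unfolding hline_def by blast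
    qed
    have "1 *s z \<in> cline z" unfolding cline_def by blast
    then have "z \<in> cline z" by simp
    then show "hline (p, q) \<subseteq> twistor (cline z)"
      unfolding twistor_def hline_def pq[symmetric] by blast
  qed
  have "p \<noteq> 0 \<or> q \<noteq> 0"
    using pq assms by (auto simp: hvec_def vec_eq_iff forall_4 zero_prod_def)
  then have inv: "norm p = norm q \<Longrightarrow> q \<noteq> 0" by auto
  have "cline z \<in> Q \<longleftrightarrow> (\<exists>x. norm x = 1 \<and> hline (p, q) = hline (x, qone))"
  proof -
    have "cline z \<in> CP3" using assms unfolding CP3_def by blast
    moreover have "x \<in> S3 \<longleftrightarrow> norm x = 1" for x by (simp add: S3_def)
    ultimately show ?thesis unfolding Q_def mem_Collect_eq tw image_iff S3_embed_def by blast
  qed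
  also have "\<dots> \<longleftrightarrow> norm p = norm q"
  proof
    assume "\<exists>x. norm x = 1 \<and> hline (p, q) = hline (x, qone)"
    then obtain x where x: "norm x = 1" "hline (p, q) = hline (x, qone)" by blast
    have "(p, q) = hscale (p, q) qone" by (simp add: hscale_def)
    then have "(p, q) \<in> hline (x, qone)" using x(2) unfolding hline_def by blast
    then obtain l where "(p, q) = hscale (x, qone) l" unfolding hline_def by blast
    then have "p = x \<odot> q" by (simp add: hscale_def)
    then show "norm p = norm q" using x by (simp add: norm_qmult)
  next
    assume eq: "norm p = norm q"
    define r where "r = (1 / (norm q)\<^sup>2) *\<^sub>R qcnj q"
    have q0: "norm q \<noteq> 0" using inv eq by simp
    have rq: "r \<odot> q = qone" and qr: "q \<odot> r = qone"
      using q0 by (simp_all add: r_def qmult_scaleR qmult_qcnj)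
    have "norm r * norm q = 1" using arg_cong[OF rq, of norm] by (simp add: norm_qmult)
    then have "norm (p \<odot> r) = 1" using eq by (simp add: norm_qmult mult.commute)
    moreover have "hline (p, q) = hline (p \<odot> r, qone)"
    proof -
      have "hscale (p, q) l = hscale (p \<odot> r, qone) (q \<odot> l)" for l
      proof -
        have "p \<odot> r \<odot> (q \<odot> l) = p \<odot> (r \<odot> q \<odot> l)" by (simp only: qmult_assoc)
        then show ?thesis using rq by (simp add: hscale_def)
      qed
      moreover have "hscale (p \<odot> r, qone) l = hscale (p, q) (r \<odot> l)" for l
      proof -
        have "q \<odot> (r \<odot> l) = q \<odot> r \<odot> l" by (simp only: qmult_assoc)
        then show ?thesis using qr by (simp add: hscale_def qmult_assoc)
      qed
      ultimately have "\<And>v. v \<in> hline (p, q) \<longleftrightarrow> v \<in> hline (p \<odot> r, qone)"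
        unfolding hline_def by blast
      then show ?thesis by blast
    qed
    ultimately show "\<exists>x. norm x = 1 \<and> hline (p, q) = hline (x, qone)" by blast
  qed
  finally show ?thesis using rhs by blast
qed

text \<open>
  The point of \<open>Q\<close> that corresponds to the oriented tangent line of the three-sphere at \<open>x\<close>
  spanned by \<open>x \<mu>\<close>, for \<open>\<mu>\<close> a unit imaginary quaternion.
\<close>

definition tangent_line_point :: "quat \<Rightarrow> quat \<Rightarrow> (complex^4) set"
  where "tangent_line_point x \<mu> = {z. \<exists>l. \<mu> \<odot> l = l \<odot> qi \<and> hvec z = hscale (x, qone) l}"

text \<open>
  An orientation of a plane is given by the set of its positively oriented ordered bases.
\<close>

definition positive_bases :: "quat \<Rightarrow> quat \<Rightarrow> (quat \<times> quat) set"
  where "positive_bases u v =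
    {(a *\<^sub>R u + b *\<^sub>R v, c *\<^sub>R u + d *\<^sub>R v) | a b c d. a * d - b * c > 0}"

definition oriented_planes :: "(quat set \<times> (quat \<times> quat) set) set"
  where "oriented_planes =
    {((+) p ` span {u, v}, positive_bases u v) | p u v. u \<noteq> v \<and> independent {u, v}}"

definition oriented_circles :: "(quat set \<times> (quat \<times> quat) set) set"
  where "oriented_circles =
    {(S3 \<inter> P, B) | P B. (P, B) \<in> oriented_planes \<and> (\<exists>x\<in>S3 \<inter> P. \<exists>y\<in>S3 \<inter> P. x \<noteq> y)}"

definition tangent_vector :: "quat set \<Rightarrow> quat \<Rightarrow> quat \<Rightarrow> bool"
  where "tangent_vector C x t \<longleftrightarrow>
    (\<exists>\<gamma>. \<gamma> 0 = x \<and> (\<forall>s::real. \<gamma> s \<in> C) \<and> (\<gamma> has_vector_derivative t) (at 0))"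

text \<open>
  The circle is traversed counterclockwise with respect to the orientation of its plane: the radius
  vector followed by the tangent vector is a positive basis. The point \<open>c\<close> below is the centre of
  the circle in its own plane, not the centre of the three-sphere.
\<close>

definition positive_tangent_vector :: "quat set \<times> (quat \<times> quat) set \<Rightarrow> quat \<Rightarrow> quat \<Rightarrow> bool"
  where "positive_tangent_vector K x t \<longleftrightarrow>
    x \<in> fst K \<and> tangent_vector (fst K) x t \<and>
    (\<exists>c r. c \<in> affine hull (fst K) \<and> fst K \<subseteq> sphere c r \<and> (x - c, t) \<in> snd K)"

definition positively_tangent :: "(complex^4) set \<Rightarrow> quat set \<times> (quat \<times> quat) set \<Rightarrow> bool"
  where "positively_tangent e K \<longleftrightarrow>
    (\<exists>x\<in>S3. \<exists>\<mu>\<in>qImag. norm \<mu> = 1 \<and> e = tangent_line_point x \<mu> \<and>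
      positive_tangent_vector K x (x \<odot> \<mu>))"

end

theory Submission
  imports Defs
begin

text \<open>
  Write \<open>[T]\<close> and \<open>[S]\<close> as tangent lines spanned by \<open>t = x \<mu>\<close> and \<open>s = y \<nu>\<close>, and let \<open>w = y - x\<close>.
  Multiplying out the form, \<open>\<Omega>(T, S) = 0\<close> says that \<open>h = cnj x y - 1\<close> intertwines \<open>\<mu>\<close> and \<open>\<nu>\<close>,
  which amounts to \<open>|w|\<^sup>2 s = w (cnj t) w = 2 \<langle>t, w\<rangle> w - |w|\<^sup>2 t\<close>: up to sign, \<open>s\<close> is the mirror image
  of \<open>t\<close> in the perpendicular bisector of \<open>x\<close> and \<open>y\<close>. This is also the relation between the unit
  tangent vectors of an oriented circle at two of its points, and it determines the tangent at \<open>y\<close>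
  of the circle that passes through \<open>y\<close> and touches \<open>t\<close> at \<open>x\<close>.
\<close>

section \<open>Quaternion conjugation, cancellation and polarization\<close>

lemma qmult_diff: "(p - p') \<odot> q = p \<odot> q - p' \<odot> q" "p \<odot> (q - q') = p \<odot> q - p \<odot> q'"
  by (simp_all add: qmult_def algebra_simps)

lemma qmult_minus: "(- p) \<odot> q = - (p \<odot> q)" "p \<odot> (- q) = - (p \<odot> q)"
  by (simp_all add: qmult_def)

lemma qcnj_qmult: "qcnj (p \<odot> q) = qcnj q \<odot> qcnj p"
  by (simp add: qmult_def qcnj_def algebra_simps)

lemma qcnj_qcnj [simp]: "qcnj (qcnj p) = p"
  by (simp add: qcnj_def)

lemma qcnj_diff: "qcnj (p - q) = qcnj p - qcnj q"
  by (simp add: qcnj_def)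

lemma qcnj_qone [simp]: "qcnj qone = qone"
  by (simp add: qcnj_def qone_def)

lemma norm_qcnj [simp]: "norm (qcnj p) = norm p"
  by (simp add: qcnj_def norm_prod_def)

lemma qcnj_qImag: "\<mu> \<in> qImag \<Longrightarrow> qcnj \<mu> = - \<mu>"
  by (simp add: qcnj_def qImag_def prod_eq_iff complex_eq_iff)

lemma qmult_polarization: "qcnj t \<odot> w + qcnj w \<odot> t = (2 * (t \<bullet> w)) *\<^sub>R qone"
  by (simp add: qmult_def qcnj_def qone_def prod_eq_iff complex_eq_iff inner_prod_def
      inner_complex_def algebra_simps)

lemma qmult_left_cancel:
  assumes "p \<noteq> 0"
  shows "p \<odot> q = p \<odot> r \<longleftrightarrow> q = r"
proof
  assume "p \<odot> q = p \<odot> r"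
  then have "norm (p \<odot> (q - r)) = 0" by (simp add: qmult_diff)
  then show "q = r" using assms by (simp add: norm_qmult)
qed simp

lemma qmult_right_cancel:
  assumes "p \<noteq> 0"
  shows "q \<odot> p = r \<odot> p \<longleftrightarrow> q = r"
proof
  assume "q \<odot> p = r \<odot> p"
  then have "norm ((q - r) \<odot> p) = 0" by (simp add: qmult_diff)
  then show "q = r" using assms by (simp add: norm_qmult)
qed simp

text \<open>The centralizer of \<open>qi\<close> is the complex subfield. This turns the vanishing
  of a \<open>j\<close>-part into a commutation relation, which can be carried through
  products.\<close>

lemma qi_commute_iff: "qi \<odot> p = p \<odot> qi \<longleftrightarrow> snd p = 0"
  by (auto simp: qmult_def qi_def prod_eq_iff complex_eq_iff)

section \<open>Vanishing of the two-form as a reflection\<close>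

text \<open>Polarization moves \<open>w\<close> past \<open>qcnj t\<close>, and
  \<open>w \<odot> qcnj w\<close> is real. For a unit vector \<open>w\<close> the result is minus
  the reflection of \<open>t\<close> in the hyperplane orthogonal to \<open>w\<close>.\<close>

lemma qmult_qcnj_qmult: "w \<odot> qcnj t \<odot> w = (2 * (t \<bullet> w)) *\<^sub>R w - (norm w)\<^sup>2 *\<^sub>R t"
proof -
  have "w \<odot> (qcnj t \<odot> w) = w \<odot> ((2 * (t \<bullet> w)) *\<^sub>R qone - qcnj w \<odot> t)"
    by (simp flip: qmult_polarization)
  also have "\<dots> = (2 * (t \<bullet> w)) *\<^sub>R w - w \<odot> qcnj w \<odot> t"
    by (simp add: qmult_diff qmult_scaleR qmult_assoc)
  finally show ?thesis by (simp add: qmult_assoc[symmetric] qmult_qcnj qmult_scaleR)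
qed

text \<open>Both sides are multiplied from the left by \<open>y \<odot> qcnj h = - w\<close>, which
  is invertible. As \<open>qcnj h \<odot> h\<close> is real, the right side becomes a multiple of
  \<open>y \<odot> \<nu>\<close>; the left side becomes
  \<open>w \<odot> qcnj (x \<odot> \<mu>) \<odot> w\<close> because
  \<open>qcnj \<mu> = - \<mu>\<close>.\<close>

lemma conjugation_iff_reflection:
  assumes x: "norm x = 1" and y: "norm y = 1" and "x \<noteq> y" and \<mu>: "\<mu> \<in> qImag"
  defines "h \<equiv> qcnj x \<odot> y - qone"
  shows "\<mu> \<odot> h = h \<odot> \<nu> \<longleftrightarrow> (norm (y - x))\<^sup>2 *\<^sub>R (y \<odot> \<nu>)
    = (2 * ((x \<odot> \<mu>) \<bullet> (y - x))) *\<^sub>R (y - x) - (norm (y - x))\<^sup>2 *\<^sub>R (x \<odot> \<mu>)"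
proof -
  define w where "w = y - x"
  have h: "h = qcnj x \<odot> w" using x by (simp add: h_def w_def qmult_diff qmult_qcnj)
  have nh: "norm h = norm w" using x by (simp add: h norm_qmult)
  have yh: "y \<odot> qcnj h = - w"
    using y by (simp add: h_def w_def qcnj_diff qcnj_qmult qmult_diff qmult_assoc[symmetric]
        qmult_qcnj)
  have "w \<noteq> 0" using \<open>x \<noteq> y\<close> by (simp add: w_def)
  then have h0: "y \<odot> qcnj h \<noteq> 0" by (simp add: yh)
  have "\<mu> \<odot> h = h \<odot> \<nu> \<longleftrightarrow> y \<odot> qcnj h \<odot> (\<mu> \<odot> h) = y \<odot> qcnj h \<odot> (h \<odot> \<nu>)"
    using qmult_left_cancel[OF h0] by simp
  also have "y \<odot> qcnj h \<odot> (h \<odot> \<nu>) = y \<odot> (qcnj h \<odot> h) \<odot> \<nu>" by (simp only: qmult_assoc)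
  also have "\<dots> = (norm w)\<^sup>2 *\<^sub>R (y \<odot> \<nu>)" by (simp add: qmult_qcnj qmult_scaleR nh)
  also have "y \<odot> qcnj h \<odot> (\<mu> \<odot> h) = w \<odot> qcnj (x \<odot> \<mu>) \<odot> w"
    unfolding yh by (simp add: h qcnj_qmult qcnj_qImag[OF \<mu>] qmult_minus qmult_assoc)
  finally show ?thesis unfolding qmult_qcnj_qmult w_def[symmetric] by auto
qed

text \<open>On \<open>(x \<odot> l, l)\<close> and \<open>(y \<odot> k, k)\<close> the quaternionic
  form is \<open>qcnj l \<odot> h \<odot> k\<close>. In the condition that it commutes with
  \<open>qi\<close>, the factors \<open>l\<close> and \<open>k\<close> exchange \<open>qi\<close>
  for \<mu> and \<nu> and then cancel.\<close>

lemma Omega_tangent_line_points: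
  assumes x: "norm x = 1" and y: "norm y = 1" and "x \<noteq> y"
    and \<mu>: "\<mu> \<in> qImag" and "T \<noteq> 0" and "S \<noteq> 0"
    and T: "T \<in> tangent_line_point x \<mu>" and S: "S \<in> tangent_line_point y \<nu>"
  shows "Omega T S = 0 \<longleftrightarrow> (norm (y - x))\<^sup>2 *\<^sub>R (y \<odot> \<nu>)
    = (2 * ((x \<odot> \<mu>) \<bullet> (y - x))) *\<^sub>R (y - x) - (norm (y - x))\<^sup>2 *\<^sub>R (x \<odot> \<mu>)"
proof -
  from T obtain l where l: "\<mu> \<odot> l = l \<odot> qi" "hvec T = (x \<odot> l, l)"
    by (auto simp: tangent_line_point_def hscale_def)
  from S obtain k where k: "\<nu> \<odot> k = k \<odot> qi" "hvec S = (y \<odot> k, k)"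
    by (auto simp: tangent_line_point_def hscale_def)
  have "l \<noteq> 0" using \<open>T \<noteq> 0\<close> l
    by (auto simp: hvec_def qmult_def prod_eq_iff vec_eq_iff forall_4)
  have k0: "k \<noteq> 0" using \<open>S \<noteq> 0\<close> k
    by (auto simp: hvec_def qmult_def prod_eq_iff vec_eq_iff forall_4)
  have l0: "qcnj l \<noteq> 0" using \<open>l \<noteq> 0\<close> by (metis norm_qcnj norm_eq_zero)
  define h where "h = qcnj x \<odot> y - qone"
  \<comment> \<open>Conjugate of \<open>\<mu> \<odot> l = l \<odot> qi\<close>; both \<mu> and
    \<open>qi\<close> are imaginary, so the signs cancel.\<close>
  have il: "qi \<odot> qcnj l = qcnj l \<odot> \<mu>"
  proof -
    have "qcnj (\<mu> \<odot> l) = qcnj (l \<odot> qi)" using l by simp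
    moreover have "qcnj qi = - qi" by (simp add: qcnj_def qi_def)
    ultimately show ?thesis by (simp add: qcnj_qmult qcnj_qImag[OF \<mu>] qmult_minus)
  qed
  have "Omega T S = snd (qcnj l \<odot> h \<odot> k)"
    by (simp only: Omega_def hform_def l k fst_conv snd_conv qcnj_qmult h_def qmult_diff
        qmult_assoc qmult_qone)
  then have "Omega T S = 0 \<longleftrightarrow> qi \<odot> (qcnj l \<odot> h \<odot> k) = qcnj l \<odot> h \<odot> k \<odot> qi"
    by (simp add: qi_commute_iff)
  also have "qi \<odot> (qcnj l \<odot> h \<odot> k) = qcnj l \<odot> (\<mu> \<odot> h \<odot> k)"
    by (simp only: qmult_assoc[symmetric] il)
  also have "qcnj l \<odot> h \<odot> k \<odot> qi = qcnj l \<odot> (h \<odot> \<nu> \<odot> k)"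
    by (simp only: qmult_assoc k)
  finally have "Omega T S = 0 \<longleftrightarrow> \<mu> \<odot> h = h \<odot> \<nu>"
    using qmult_left_cancel[OF l0] qmult_right_cancel[OF k0] by simp
  then show ?thesis
    using conjugation_iff_reflection[OF x y \<open>x \<noteq> y\<close> \<mu>, of \<nu>] unfolding h_def by blast
qed

section \<open>Points of \<open>Q\<close> as oriented tangent lines\<close>

text \<open>The second coordinate \<open>l\<close> of a nonzero vector is invertible, so this vector
  alone generates the quaternionic line. Consequently different twistor images force different base
  points.\<close>

lemma twistor_tangent_line_point:
  assumes "z \<noteq> 0" and z: "z \<in> tangent_line_point x \<mu>"
  shows "twistor (tangent_line_point x \<mu>) = hline (x, qone)"
proof
  show "twistor (tangent_line_point x \<mu>) \<subseteq> hline (x, qone)"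
    unfolding twistor_def tangent_line_point_def hline_def hscale_def
    by (clarsimp simp: qmult_assoc simp del: split_paired_Ex)
  from z obtain l where l: "hvec z = (x \<odot> l, l)"
    by (auto simp: tangent_line_point_def hscale_def)
  have l0: "norm l \<noteq> 0" using \<open>z \<noteq> 0\<close> l
    by (auto simp: hvec_def qmult_def prod_eq_iff vec_eq_iff forall_4)
  have "(x \<odot> m, m) = hscale (hvec z) ((1 / (norm l)\<^sup>2) *\<^sub>R (qcnj l \<odot> m))" for m
    using l0 by (simp add: l hscale_def qmult_scaleR qmult_assoc)
      (simp add: qmult_assoc[symmetric] qmult_qcnj qmult_scaleR qmult_assoc[of x])
  then show "hline (x, qone) \<subseteq> twistor (tangent_line_point x \<mu>)"
    using z unfolding twistor_def hline_def by (fastforce simp: hscale_def)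
qed

lemma mem_cline: "z \<in> cline z"
proof -
  have "1 *s z \<in> cline z" unfolding cline_def by blast
  then show ?thesis by simp
qed

text \<open>For \<open>hvec z = (p, q)\<close> the equations \<open>x \<odot> q = p\<close> and
  \<open>\<mu> \<odot> q = q \<odot> qi\<close> are solved by means of the inverse \<open>r\<close>
  of \<open>q\<close>; \<open>norm p = norm q\<close> makes \<open>x\<close> a unit vector.\<close>

lemma Q_tangent_line_point:
  assumes "z \<noteq> 0" and "cline z \<in> Q"
  obtains x \<mu> where "norm x = 1" "\<mu> \<in> qImag" "norm \<mu> = 1" "cline z = tangent_line_point x \<mu>"
proof -
  obtain p q where pq: "hvec z = (p, q)" by (cases "hvec z")
  have "(norm p)\<^sup>2 = (norm q)\<^sup>2"
    using assms pq by (auto simp: mem_Q_iff hvec_def norm_Pair)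
  then have npq: "norm p = norm q" by simp
  then have q0: "norm q \<noteq> 0" using pq \<open>z \<noteq> 0\<close>
    by (cases "q = 0") (auto simp: hvec_def vec_eq_iff forall_4 zero_prod_def)
  define r where "r = (1 / (norm q)\<^sup>2) *\<^sub>R qcnj q"
  have rq: "r \<odot> q = qone" and qr: "q \<odot> r = qone"
    using q0 by (simp_all add: r_def qmult_scaleR qmult_qcnj)
  have nr: "norm q * norm r = 1" using arg_cong[OF qr, of norm] by (simp add: norm_qmult)
  have ni: "norm qi = 1" by (simp add: qi_def norm_Pair)
  define x where "x = p \<odot> r"
  define \<mu> where "\<mu> = q \<odot> qi \<odot> r"
  have xq: "x \<odot> q = p" by (simp add: x_def qmult_assoc rq)
  have \<mu>q: "\<mu> \<odot> q = q \<odot> qi" by (simp add: \<mu>_def qmult_assoc rq)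
  show thesis
  proof
    show "norm x = 1" using npq nr by (simp add: x_def norm_qmult)
    show "norm \<mu> = 1" using nr ni by (simp add: \<mu>_def norm_qmult)
    \<comment> \<open>Up to a real factor this quaternion is \<mu>; its first component is \<i>
      times a real number.\<close>
    have "fst (q \<odot> qi \<odot> qcnj q) = \<i> * (fst q * cnj (fst q) - snd q * cnj (snd q))"
      by (simp add: qmult_def qcnj_def qi_def algebra_simps)
    then show "\<mu> \<in> qImag"
      by (simp add: qImag_def \<mu>_def r_def qmult_scaleR)
    show "cline z = tangent_line_point x \<mu>"
    proof (intro equalityI subsetI)
      fix v assume "v \<in> cline z"
      then obtain c where "v = c *s z" by (auto simp: cline_def)
      then have "hvec v = hscale (x, qone) (q \<odot> (c, 0))"
        by (simp add: hvec_scale pq hscale_def xq qmult_assoc[symmetric])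
      moreover have "\<mu> \<odot> (q \<odot> (c, 0)) = q \<odot> (c, 0) \<odot> qi"
        by (simp add: qmult_assoc[symmetric] \<mu>q)
          (simp add: qmult_assoc qi_def, simp add: qmult_def mult.commute)
      ultimately show "v \<in> tangent_line_point x \<mu>" unfolding tangent_line_point_def by blast
    next
      fix v assume "v \<in> tangent_line_point x \<mu>"
      then obtain l where l: "\<mu> \<odot> l = l \<odot> qi" "hvec v = hscale (x, qone) l"
        by (auto simp: tangent_line_point_def)
      \<comment> \<open>The condition on \<open>l\<close> makes \<open>r \<odot> l\<close> commute
        with \<open>qi\<close>, so it is a complex number: the factor by which \<open>v\<close> is a
        multiple of \<open>z\<close>.\<close>
      have "r \<odot> (\<mu> \<odot> l) = r \<odot> q \<odot> qi \<odot> (r \<odot> l)" by (simp only: \<mu>_def qmult_assoc)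
      then have "qi \<odot> (r \<odot> l) = (r \<odot> l) \<odot> qi" by (simp add: rq l qmult_assoc)
      then have "snd (r \<odot> l) = 0" by (simp add: qi_commute_iff)
      then have rl: "r \<odot> l = (fst (r \<odot> l), 0)" by (simp add: prod_eq_iff)
      have "l = q \<odot> (r \<odot> l)" by (simp add: qmult_assoc[symmetric] qr)
      then have lq: "l = q \<odot> (fst (r \<odot> l), 0)" using rl by simp
      have "hvec (fst (r \<odot> l) *s z) = (x \<odot> q \<odot> (fst (r \<odot> l), 0), q \<odot> (fst (r \<odot> l), 0))"
        by (simp only: hvec_scale pq hscale_def xq fst_conv snd_conv)
      also have "\<dots> = (x \<odot> l, l)" using lq by (simp only: qmult_assoc lq[symmetric])
      also have "\<dots> = hvec v" using l by (simp add: hscale_def)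
      finally have "v = fst (r \<odot> l) *s z" by (simp add: hvec_def vec_eq_iff forall_4)
      then show "v \<in> cline z" unfolding cline_def by blast
    qed
  qed
qed

section \<open>Tangent vectors at two points of one oriented circle\<close>

text \<open>The difference of the two sphere equations is affine in \<open>z\<close>, so it holds on
  the affine hull, in particular at both centres; hence \<open>c' - c\<close> is orthogonal to
  itself. A positive tangent vector only asserts that some centre exists, and this makes the centres
  for two such vectors agree.\<close>

lemma sphere_centre_unique:
  fixes c :: "'a::real_inner"
  assumes "c \<in> affine hull C" "c' \<in> affine hull C" "C \<subseteq> sphere c r" "C \<subseteq> sphere c' r'"
  shows "c = c'"
proof -
  define b where "b = (r\<^sup>2 - r'\<^sup>2 - c \<bullet> c + c' \<bullet> c') / 2"
  have "(c' - c) \<bullet> z = b" if "z \<in> C" for z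
  proof -
    have "(norm (c - z))\<^sup>2 = r\<^sup>2" "(norm (c' - z))\<^sup>2 = r'\<^sup>2"
      using that assms by (auto simp: dist_norm)
    then show ?thesis
      by (simp add: b_def power2_norm_eq_inner inner_diff inner_commute field_simps)
  qed
  then have "affine hull C \<subseteq> {z. (c' - c) \<bullet> z = b}"
    by (intro hull_minimal affine_hyperplane) auto
  then have "(c' - c) \<bullet> c = b" "(c' - c) \<bullet> c' = b" using assms by auto
  then have "(c' - c) \<bullet> (c' - c) = 0" by (simp only: inner_diff_right)
  then show ?thesis by simp
qed

text \<open>The squared distance to \<open>c\<close> is constant along the curve, and its derivative
  at 0 is twice the inner product.\<close>

lemma tangent_vector_orthogonal_radius:
  assumes "tangent_vector C x t" and C: "C \<subseteq> sphere c r"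
  shows "(x - c) \<bullet> t = 0"
proof -
  obtain \<gamma> where \<gamma>: "\<gamma> 0 = x" "\<And>s::real. \<gamma> s \<in> C" "(\<gamma> has_vector_derivative t) (at 0)"
    using assms unfolding tangent_vector_def by blast
  have "((\<lambda>s. (\<gamma> s - c) \<bullet> (\<gamma> s - c)) has_vector_derivative
      ((\<gamma> 0 - c) \<bullet> (t - 0) + (t - 0) \<bullet> (\<gamma> 0 - c))) (at 0)"
    by (intro bounded_bilinear.has_vector_derivative[OF bounded_bilinear_inner]
        has_vector_derivative_diff \<gamma> has_vector_derivative_const)
  moreover have "(\<gamma> s - c) \<bullet> (\<gamma> s - c) = r\<^sup>2" for s
    using \<gamma>(2)[of s] C by (auto simp: dist_norm norm_minus_commute simp flip: power2_norm_eq_inner)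
  ultimately have "((\<lambda>s::real. r\<^sup>2) has_vector_derivative
      ((\<gamma> 0 - c) \<bullet> (t - 0) + (t - 0) \<bullet> (\<gamma> 0 - c))) (at 0)"
    by simp
  then have "(\<gamma> 0 - c) \<bullet> (t - 0) + (t - 0) \<bullet> (\<gamma> 0 - c) = 0"
    using vector_derivative_unique_at has_vector_derivative_const by blast
  then show ?thesis using \<gamma>(1) by (simp add: inner_commute)
qed

lemma positive_bases_change:
  assumes "(a, t) \<in> positive_bases u v" and "(b, s) \<in> positive_bases u v"
  shows "(b, s) \<in> positive_bases a t"
proof -
  obtain a1 a2 a3 a4 where a: "a = a1 *\<^sub>R u + a2 *\<^sub>R v" "t = a3 *\<^sub>R u + a4 *\<^sub>R v"
    "a1 * a4 - a2 * a3 > 0" using assms(1) unfolding positive_bases_def by blast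
  obtain b1 b2 b3 b4 where b: "b = b1 *\<^sub>R u + b2 *\<^sub>R v" "s = b3 *\<^sub>R u + b4 *\<^sub>R v"
    "b1 * b4 - b2 * b3 > 0" using assms(2) unfolding positive_bases_def by blast
  define D where "D = a1 * a4 - a2 * a3"
  have D: "D > 0" using a by (simp add: D_def)
  \<comment> \<open>Cramer's rule for coordinates with respect to \<open>a\<close> and
    \<open>t\<close>.\<close>
  have comb: "p *\<^sub>R u + q *\<^sub>R v
    = ((p * a4 - q * a3) / D) *\<^sub>R a + ((q * a1 - p * a2) / D) *\<^sub>R t" for p q
  proof -
    have "(p * a4 - q * a3) / D * a1 + (q * a1 - p * a2) / D * a3 = p"
      "(p * a4 - q * a3) / D * a2 + (q * a1 - p * a2) / D * a4 = q"
      using D by (simp_all add: field_simps) (simp_all add: D_def algebra_simps)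
    then have "p *\<^sub>R u + q *\<^sub>R v
      = ((p * a4 - q * a3) / D * a1 + (q * a1 - p * a2) / D * a3) *\<^sub>R u
      + ((p * a4 - q * a3) / D * a2 + (q * a1 - p * a2) / D * a4) *\<^sub>R v" by simp
    then show ?thesis unfolding a by (simp add: algebra_simps)
  qed
  \<comment> \<open>Multiplicativity of the determinant, cleared of denominators.\<close>
  have "(b1 * a4 - b2 * a3) * (b4 * a1 - b3 * a2) - (b2 * a1 - b1 * a2) * (b3 * a4 - b4 * a3)
      = (b1 * b4 - b2 * b3) * D"
    by (simp add: D_def algebra_simps)
  then have "(b1 * a4 - b2 * a3) / D * ((b4 * a1 - b3 * a2) / D)
      - (b2 * a1 - b1 * a2) / D * ((b3 * a4 - b4 * a3) / D) = (b1 * b4 - b2 * b3) * D / (D * D)"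
    by (simp only: times_divide_times_eq diff_divide_distrib[symmetric])
  also have "\<dots> > 0" using b D by simp
  finally show ?thesis unfolding positive_bases_def mem_Collect_eq
    using comb[of b1 b2] comb[of b3 b4] b by blast
qed

text \<open>Once \<open>a\<close> and \<open>b\<close> are divided by their common length, both
  pairs are orthonormal bases of the same orientation, so they differ by a rotation. The identity is
  then checked in coordinates with respect to \<open>a\<close> and \<open>t\<close>.\<close>

lemma reflection_of_positive_orthogonal_bases:
  assumes at: "(a, t) \<in> positive_bases u v" and bs: "(b, s) \<in> positive_bases u v"
    and "a \<bullet> t = 0" "b \<bullet> s = 0" "norm t = 1" "norm s = 1" "norm a = norm b"
  shows "(norm (b - a))\<^sup>2 *\<^sub>R s = (2 * (t \<bullet> (b - a))) *\<^sub>R (b - a) - (norm (b - a))\<^sup>2 *\<^sub>R t"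
proof (cases "a = 0")
  case True
  then have "b = 0" using assms by simp
  then show ?thesis using True by simp
next
  case False
  define R where "R = a \<bullet> a"
  have R: "R > 0" using False by (simp add: R_def)
  obtain \<alpha> \<beta> \<gamma> \<delta> where b: "b = \<alpha> *\<^sub>R a + \<beta> *\<^sub>R t" and s: "s = \<gamma> *\<^sub>R a + \<delta> *\<^sub>R t"
    and pos: "\<alpha> * \<delta> - \<beta> * \<gamma> > 0"
    using positive_bases_change[OF at bs] unfolding positive_bases_def by blast
  have tt: "t \<bullet> t = 1" and ss: "s \<bullet> s = 1" and bb: "b \<bullet> b = R"
    using assms by (simp_all add: R_def flip: power2_norm_eq_inner)
  have ta: "t \<bullet> a = 0" using \<open>a \<bullet> t = 0\<close> by (simp add: inner_commute)
  note ip = inner_add inner_diff ta \<open>a \<bullet> t = 0\<close> tt R_def[symmetric]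
  have 1: "\<alpha>\<^sup>2 * R + \<beta>\<^sup>2 = R" using bb by (simp add: b ip power2_eq_square)
  have 2: "\<gamma>\<^sup>2 * R + \<delta>\<^sup>2 = 1" using ss by (simp add: s ip power2_eq_square)
  have 3: "\<alpha> * \<gamma> * R + \<beta> * \<delta> = 0" using \<open>b \<bullet> s = 0\<close> by (simp add: b s ip algebra_simps)
  \<comment> \<open>The determinant of the transition matrix. The next two relations say that the
    adjugate of an orthogonal matrix is its determinant times its transpose; the factors
    \<open>R\<close> appear because \<open>a\<close> is not normalized.\<close>
  define k where "k = \<alpha> * \<delta> - \<beta> * \<gamma>"
  have "R * (\<alpha> * k) - R * \<delta> = \<delta> * (\<alpha>\<^sup>2 * R + \<beta>\<^sup>2 - R) - \<beta> * (\<alpha> * \<gamma> * R + \<beta> * \<delta>)"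
    by (simp add: k_def power2_eq_square algebra_simps)
  then have \<alpha>k: "\<alpha> * k = \<delta>" using R 1 3 by simp
  have "\<beta> * k + \<gamma> * R = \<gamma> * (R - (\<alpha>\<^sup>2 * R + \<beta>\<^sup>2)) + \<alpha> * (\<alpha> * \<gamma> * R + \<beta> * \<delta>)"
    by (simp add: k_def power2_eq_square algebra_simps)
  then have \<beta>k: "\<beta> * k = - \<gamma> * R" using 1 3 by simp
  have "R * k\<^sup>2 = (\<alpha>\<^sup>2 * R + \<beta>\<^sup>2) * k\<^sup>2" using 1 by simp
  also have "\<dots> = (\<alpha> * k)\<^sup>2 * R + (\<beta> * k)\<^sup>2" by (simp add: power2_eq_square algebra_simps)
  also have "\<dots> = R * (\<gamma>\<^sup>2 * R + \<delta>\<^sup>2)"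
    unfolding \<alpha>k \<beta>k by (simp add: power2_eq_square algebra_simps)
  finally have "R * k\<^sup>2 = R" using 2 by simp
  then have "k\<^sup>2 = 1" using R by simp
  then have "k = 1" using pos by (simp add: k_def power2_eq_1_iff)
  then have \<delta>: "\<delta> = \<alpha>" and \<beta>: "\<beta> = - \<gamma> * R" using \<alpha>k \<beta>k by auto
  have w: "b - a = (\<alpha> - 1) *\<^sub>R a + \<beta> *\<^sub>R t" by (simp add: b algebra_simps)
  have tw: "t \<bullet> (b - a) = \<beta>" by (simp add: w ip)
  have N: "(norm (b - a))\<^sup>2 = 2 * R - 2 * \<alpha> * R"
  proof -
    have "(norm (b - a))\<^sup>2 = (\<alpha> - 1)\<^sup>2 * R + \<beta>\<^sup>2"
      unfolding power2_norm_eq_inner w by (simp add: ip power2_eq_square)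
    then show ?thesis using 1 by (simp add: power2_eq_square algebra_simps)
  qed
  \<comment> \<open>Coefficients of \<open>a\<close> and \<open>t\<close> in the identity to be
    shown.\<close>
  have "(2 * R - 2 * \<alpha> * R) * \<gamma> = 2 * \<beta> * (\<alpha> - 1)"
    by (simp add: \<beta> algebra_simps)
  moreover have "(2 * R - 2 * \<alpha> * R) * \<alpha> = 2 * \<beta> * \<beta> - (2 * R - 2 * \<alpha> * R)"
    using 1 by (simp add: power2_eq_square algebra_simps)
  ultimately have "((2 * R - 2 * \<alpha> * R) * \<gamma>) *\<^sub>R a + ((2 * R - 2 * \<alpha> * R) * \<alpha>) *\<^sub>R t
    = (2 * \<beta> * (\<alpha> - 1)) *\<^sub>R a + (2 * \<beta> * \<beta> - (2 * R - 2 * \<alpha> * R)) *\<^sub>R t"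
    by simp
  then show ?thesis unfolding N tw unfolding w s \<delta> by (simp add: algebra_simps)
qed

text \<open>Each tangent vector brings its own centre. Once these agree, \<open>x - c\<close> and
  \<open>y - c\<close> have equal length, are orthogonal to the tangents, and differ by
  \<open>y - x\<close>.\<close>

lemma reflection_of_positive_tangent_vectors:
  assumes "(C, B) \<in> oriented_circles"
    and x: "positive_tangent_vector (C, B) x t" and y: "positive_tangent_vector (C, B) y s"
    and "norm t = 1" "norm s = 1"
  shows "(norm (y - x))\<^sup>2 *\<^sub>R s = (2 * (t \<bullet> (y - x))) *\<^sub>R (y - x) - (norm (y - x))\<^sup>2 *\<^sub>R t"
proof -
  obtain u v where B: "B = positive_bases u v"
    using assms(1) unfolding oriented_circles_def oriented_planes_def by blast
  obtain c r where c: "c \<in> affine hull C" "C \<subseteq> sphere c r" "(x - c, t) \<in> B"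
    using x unfolding positive_tangent_vector_def by auto
  obtain c' r' where c': "c' \<in> affine hull C" "C \<subseteq> sphere c' r'" "(y - c', s) \<in> B"
    using y unfolding positive_tangent_vector_def by auto
  have cc: "c' = c" using sphere_centre_unique[OF c'(1) c(1) c'(2) c(2)] .
  have xy: "x \<in> C" "y \<in> C" "tangent_vector C x t" "tangent_vector C y s"
    using x y by (auto simp: positive_tangent_vector_def)
  then have "norm (x - c) = norm (y - c)"
    using c(2) by (metis mem_sphere subsetD dist_norm dist_commute)
  moreover have "(x - c) \<bullet> t = 0" "(y - c) \<bullet> s = 0"
    using tangent_vector_orthogonal_radius xy c(2) by blast+
  ultimately show ?thesis
    using reflection_of_positive_orthogonal_bases[of "x - c" t u v "y - c" s] assms c(3) c'(3)
    by (simp add: B cc)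
qed

section \<open>The circle with a given centre, radius vector and tangent vector\<close>

lemma span_pair: "span {a, t} = {\<alpha> *\<^sub>R a + \<beta> *\<^sub>R t | \<alpha> \<beta>. True}"
proof -
  have "z \<in> span {a, t} \<longleftrightarrow> (\<exists>\<alpha> \<beta>. z = \<alpha> *\<^sub>R a + \<beta> *\<^sub>R t)" for z
    by (auto simp: span_insert span_singleton diff_eq_eq add.commute)
  then show ?thesis by blast
qed

context
  fixes c a t :: quat
  assumes ca: "c \<bullet> a = 0" and ct: "c \<bullet> t = 0" and at: "a \<bullet> t = 0" and t1: "norm t = 1"
    and a0: "a \<noteq> 0" and ca1: "(norm c)\<^sup>2 + (norm a)\<^sup>2 = 1"
begin

private lemma norm_plane: "(norm (\<alpha> *\<^sub>R a + \<beta> *\<^sub>R t))\<^sup>2 = \<alpha>\<^sup>2 * (norm a)\<^sup>2 + \<beta>\<^sup>2"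
proof -
  have "t \<bullet> t = 1" using t1 by (simp flip: power2_norm_eq_inner)
  then show ?thesis
    using at
    by (simp add: power2_norm_eq_inner inner_add inner_commute[of t a]) (simp add: power2_eq_square)
qed

text \<open>As \<open>c\<close> is orthogonal to the plane, Pythagoras leaves a condition on the
  coordinates alone. It is not symmetric because \<open>t\<close> has length 1 and \<open>a\<close>
  has the length of the radius.\<close>

private lemma circle_iff:
  "z \<in> S3 \<inter> (+) c ` span {a, t} \<longleftrightarrow>
    (\<exists>\<alpha> \<beta>. z = c + (\<alpha> *\<^sub>R a + \<beta> *\<^sub>R t) \<and> \<alpha>\<^sup>2 * (norm a)\<^sup>2 + \<beta>\<^sup>2 = (norm a)\<^sup>2)"
proof -
  have "c + (\<alpha> *\<^sub>R a + \<beta> *\<^sub>R t) \<in> S3 \<longleftrightarrow> \<alpha>\<^sup>2 * (norm a)\<^sup>2 + \<beta>\<^sup>2 = (norm a)\<^sup>2" for \<alpha> \<beta>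
  proof -
    have "orthogonal c (\<alpha> *\<^sub>R a + \<beta> *\<^sub>R t)" using ca ct by (simp add: orthogonal_def inner_add)
    then have "(norm (c + (\<alpha> *\<^sub>R a + \<beta> *\<^sub>R t)))\<^sup>2 = (norm c)\<^sup>2 + (\<alpha>\<^sup>2 * (norm a)\<^sup>2 + \<beta>\<^sup>2)"
      by (simp add: norm_add_Pythagorean norm_plane)
    moreover have "z \<in> S3 \<longleftrightarrow> (norm z)\<^sup>2 = 1" for z
      by (auto simp: S3_def power2_eq_1_iff) (smt (verit) norm_ge_zero)
    ultimately show ?thesis using ca1 by auto
  qed
  then show ?thesis unfolding span_pair by blast
qed

text \<open>These two points show that the intersection is a genuine circle, and their midpoint puts
  \<open>c\<close> into its affine hull.\<close>

private lemma circle_endpoints: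
  "c + a \<in> S3 \<inter> (+) c ` span {a, t}" "c - a \<in> S3 \<inter> (+) c ` span {a, t}"
  unfolding circle_iff
  by (rule exI[of _ 1], rule exI[of _ 0], simp, rule exI[of _ "-1"], rule exI[of _ 0], simp)

private lemma circle_oriented:
  "(S3 \<inter> (+) c ` span {a, t}, positive_bases a t) \<in> oriented_circles"
proof -
  have at': "a \<noteq> t" "t \<noteq> 0" using at a0 t1 by auto
  then have "independent {a, t}"
    using at a0 by (intro pairwise_orthogonal_independent)
      (auto simp: pairwise_def orthogonal_def inner_commute)
  then have "((+) c ` span {a, t}, positive_bases a t) \<in> oriented_planes"
    unfolding oriented_planes_def using at' by blast
  moreover have "c + a \<noteq> c - a"
  proof
    assume "c + a = c - a"
    then have "a \<bullet> a = - (a \<bullet> a)" by (metis add_left_cancel diff_conv_add_uminus inner_minus_right)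
    then show False using a0 by simp
  qed
  ultimately show ?thesis using circle_endpoints unfolding oriented_circles_def by blast
qed

text \<open>With \<open>r = norm a\<close>, the quarter turn sending \<open>a\<close> to
  \<open>r t\<close> and \<open>t\<close> to \<open>- a / r\<close>, followed by division by
  \<open>r\<close>, takes the radius vector to this tangent vector.\<close>

private lemma circle_positive_tangent_vector:
  assumes \<alpha>\<beta>: "\<alpha>\<^sup>2 * (norm a)\<^sup>2 + \<beta>\<^sup>2 = (norm a)\<^sup>2"
  shows "positive_tangent_vector (S3 \<inter> (+) c ` span {a, t}, positive_bases a t)
    (c + (\<alpha> *\<^sub>R a + \<beta> *\<^sub>R t)) (\<alpha> *\<^sub>R t - (\<beta> / (norm a)\<^sup>2) *\<^sub>R a)"
    (is "positive_tangent_vector (?C, _) (c + ?b) ?s")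
proof -
  define r where "r = norm a"
  have r: "r > 0" using a0 by (simp add: r_def)
  \<comment> \<open>Unit-speed parametrization of the circle, starting at
    \<open>c + ?b\<close>.\<close>
  define \<gamma> where "\<gamma> \<tau> = c + (cos (\<tau> / r) *\<^sub>R ?b + (r * sin (\<tau> / r)) *\<^sub>R ?s)" for \<tau>
  have "\<gamma> \<tau> \<in> ?C" for \<tau>
    unfolding circle_iff
  proof (intro exI conjI)
    let ?A = "cos (\<tau> / r) * \<alpha> - sin (\<tau> / r) * \<beta> / r"
    let ?B = "cos (\<tau> / r) * \<beta> + r * sin (\<tau> / r) * \<alpha>"
    have "r * sin (\<tau> / r) * (\<beta> / r\<^sup>2) = sin (\<tau> / r) * \<beta> / r"
      using r by (simp add: power2_eq_square)
    then show "\<gamma> \<tau> = c + (?A *\<^sub>R a + ?B *\<^sub>R t)"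
      by (simp add: \<gamma>_def r_def[symmetric] algebra_simps)
    have "?A * r = cos (\<tau> / r) * \<alpha> * r - sin (\<tau> / r) * \<beta>"
      using r by (simp add: field_simps)
    then have "?A\<^sup>2 * r\<^sup>2 + ?B\<^sup>2
      = (cos (\<tau> / r) * \<alpha> * r - sin (\<tau> / r) * \<beta>)\<^sup>2 + (cos (\<tau> / r) * \<beta> + r * sin (\<tau> / r) * \<alpha>)\<^sup>2"
      by (simp only: power_mult_distrib[symmetric])
    also have "\<dots> = ((sin (\<tau> / r))\<^sup>2 + (cos (\<tau> / r))\<^sup>2) * (\<alpha>\<^sup>2 * r\<^sup>2 + \<beta>\<^sup>2)"
      by algebra
    also have "\<dots> = r\<^sup>2" using \<alpha>\<beta> by (simp add: r_def)
    finally show "?A\<^sup>2 * (norm a)\<^sup>2 + ?B\<^sup>2 = (norm a)\<^sup>2" by (simp only: r_def)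
  qed
  moreover have "\<gamma> 0 = c + ?b" by (simp add: \<gamma>_def)
  moreover have "(\<gamma> has_vector_derivative ?s) (at 0)"
  proof -
    have "((\<lambda>\<tau>. cos (\<tau> / r)) has_real_derivative 0) (at 0)"
      using r by (auto intro!: derivative_eq_intros)
    moreover have "((\<lambda>\<tau>. r * sin (\<tau> / r)) has_real_derivative 1) (at 0)"
      using r by (auto intro!: derivative_eq_intros)
    ultimately have "(\<gamma> has_vector_derivative 0 + ((cos (0 / r) *\<^sub>R 0 + 0 *\<^sub>R ?b)
        + ((r * sin (0 / r)) *\<^sub>R 0 + 1 *\<^sub>R ?s))) (at 0)"
      unfolding \<gamma>_def
      by (intro has_vector_derivative_add has_vector_derivative_const has_vector_derivative_scaleR)
    then show ?thesis by simp
  qed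
  ultimately have "tangent_vector ?C (c + ?b) ?s" unfolding tangent_vector_def by metis
  moreover have "c + ?b \<in> ?C" unfolding circle_iff using \<alpha>\<beta> by blast
  moreover have "c \<in> affine hull ?C"
  proof -
    have "(1/2) *\<^sub>R (c + a) + (1/2) *\<^sub>R (c - a) \<in> affine hull ?C"
      using circle_endpoints by (intro mem_affine[OF affine_affine_hull] hull_inc) auto
    then show ?thesis by (simp add: algebra_simps flip: scaleR_add_left)
  qed
  moreover have "?C \<subseteq> sphere c r"
  proof
    fix z assume "z \<in> ?C"
    then obtain \<alpha> \<beta> where z: "z = c + (\<alpha> *\<^sub>R a + \<beta> *\<^sub>R t)"
      "\<alpha>\<^sup>2 * (norm a)\<^sup>2 + \<beta>\<^sup>2 = (norm a)\<^sup>2" unfolding circle_iff by blast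
    then have "(norm (\<alpha> *\<^sub>R a + \<beta> *\<^sub>R t))\<^sup>2 = r\<^sup>2" by (simp add: norm_plane r_def)
    then have "dist z c = r" using r by (simp add: z dist_norm)
    then show "z \<in> sphere c r" by (simp add: dist_commute)
  qed
  moreover have "(?b, ?s) \<in> positive_bases a t"
  proof -
    have "?s = (- \<beta> / r\<^sup>2) *\<^sub>R a + \<alpha> *\<^sub>R t" by (simp add: r_def)
    \<comment> \<open>Determinant of \<open>(?b, ?s)\<close> in the basis \<open>(a, t)\<close>; the
      circle equation makes it 1.\<close>
    moreover have "\<alpha> * \<alpha> - \<beta> * (- \<beta> / r\<^sup>2) = (\<alpha>\<^sup>2 * r\<^sup>2 + \<beta>\<^sup>2) / r\<^sup>2"
      using r by (simp add: field_simps power2_eq_square)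
    then have "\<alpha> * \<alpha> - \<beta> * (- \<beta> / r\<^sup>2) > 0" using \<alpha>\<beta> r by (simp add: r_def)
    ultimately show ?thesis unfolding positive_bases_def by blast
  qed
  ultimately show ?thesis unfolding positive_tangent_vector_def fst_conv snd_conv
    by (intro conjI exI[of _ c] exI[of _ r]) simp_all
qed

lemma circle_through_tangent_vectors:
  obtains K where "K \<in> oriented_circles"
    and "\<And>\<alpha> \<beta>. \<alpha>\<^sup>2 * (norm a)\<^sup>2 + \<beta>\<^sup>2 = (norm a)\<^sup>2 \<Longrightarrow>
      positive_tangent_vector K (c + (\<alpha> *\<^sub>R a + \<beta> *\<^sub>R t)) (\<alpha> *\<^sub>R t - (\<beta> / (norm a)\<^sup>2) *\<^sub>R a)"
  using circle_oriented circle_positive_tangent_vector by blast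

end

section \<open>Construction of a circle from the reflection relation\<close>

text \<open>The circle lies in the plane through \<open>x\<close> spanned by \<open>t\<close> and
  \<open>w\<close>, touches \<open>t\<close> at \<open>x\<close> and passes through
  \<open>y\<close>. The hypothesis on \<open>s\<close> identifies \<open>s\<close> as its tangent at
  \<open>y\<close>.\<close>

lemma exists_circle_of_reflection:
  assumes x: "norm x = 1" and y: "norm y = 1" and "x \<noteq> y" and xt: "x \<bullet> t = 0" and t: "norm t = 1"
    and s: "(norm (y - x))\<^sup>2 *\<^sub>R s
      = (2 * (t \<bullet> (y - x))) *\<^sub>R (y - x) - (norm (y - x))\<^sup>2 *\<^sub>R t"
  obtains K where "K \<in> oriented_circles"
    "positive_tangent_vector K x t" "positive_tangent_vector K y s"
proof -
  define w where "w = y - x"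
  define m where "m = t \<bullet> w"
  \<comment> \<open>The centre of the circle is \<open>x + k e\<close>, with \<open>e\<close> the part of \<open>w\<close> orthogonal to \<open>t\<close> and \<open>k\<close>
    chosen so that \<open>x\<close> and \<open>y\<close> are equidistant from it.\<close>
  define e where "e = w - m *\<^sub>R t"
  define N where "N = w \<bullet> w"
  define E where "E = e \<bullet> e"
  have tt: "t \<bullet> t = 1" and xx: "x \<bullet> x = 1" and yy: "y \<bullet> y = 1"
    using t x y by (simp_all flip: power2_norm_eq_inner)
  have et: "e \<bullet> t = 0" by (simp add: e_def inner_diff tt m_def inner_commute)
  have N0: "N > 0" using \<open>x \<noteq> y\<close> by (simp add: N_def w_def)
  have NE: "N = E + m\<^sup>2"
    by (simp add: N_def E_def e_def inner_diff tt m_def inner_commute[of w t] power2_eq_square)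
  \<comment> \<open>For unit vectors, \<open>x \<bullet> w\<close> is \<open>- N / 2\<close>. Being
    nonzero, it keeps \<open>w\<close> from being a multiple of \<open>t\<close>: a chord of the
    sphere is not tangent to it.\<close>
  have xe: "x \<bullet> e = - N / 2"
    by (simp add: e_def inner_diff xt N_def w_def xx yy inner_commute[of y x])
  have E0: "E > 0"
  proof -
    have "e \<noteq> 0" using xe N0 by auto
    then show ?thesis by (simp add: E_def)
  qed
  define k where "k = N / (2 * E)"
  have k0: "k > 0" and kE: "2 * k * E = N" using N0 E0 by (simp_all add: k_def)
  define a where "a = - k *\<^sub>R e"
  define c where "c = x - a"
  have aa: "a \<bullet> a = k * N / 2" using kE by (simp add: a_def E_def[symmetric])
  \<comment> \<open>Agreement with \<open>a \<bullet> a\<close> makes \<open>c\<close> orthogonal to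
    \<open>a\<close>, so \<open>c\<close> is the foot of the perpendicular from the origin to the
    plane.\<close>
  have xa: "x \<bullet> a = k * N / 2" by (simp add: a_def xe)
  have na: "(norm a)\<^sup>2 = k * N / 2" by (simp add: power2_norm_eq_inner aa)
  have "a \<noteq> 0" using aa k0 N0 by auto
  moreover have at: "a \<bullet> t = 0" by (simp add: a_def et)
  moreover have "c \<bullet> a = 0" "c \<bullet> t = 0"
    by (simp_all add: c_def inner_diff aa xa xt at)
  moreover have "(norm c)\<^sup>2 + (norm a)\<^sup>2 = 1"
    by (simp add: power2_norm_eq_inner c_def inner_diff aa xa xx inner_commute[of a x])
  ultimately obtain K where K: "K \<in> oriented_circles"
    and tan: "\<And>\<alpha> \<beta>. \<alpha>\<^sup>2 * (norm a)\<^sup>2 + \<beta>\<^sup>2 = (norm a)\<^sup>2 \<Longrightarrow>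
      positive_tangent_vector K (c + (\<alpha> *\<^sub>R a + \<beta> *\<^sub>R t)) (\<alpha> *\<^sub>R t - (\<beta> / (norm a)\<^sup>2) *\<^sub>R a)"
    using circle_through_tangent_vectors[of c a t] t by metis
  have "positive_tangent_vector K x t" using tan[of 1 0] by (simp add: c_def)
  moreover have "positive_tangent_vector K y s"
  proof -
    \<comment> \<open>The coordinates of \<open>y - c\<close> are \<alpha> and \<open>m\<close>,
      since \<open>y - c = (1 - k) e + m t\<close> and \<open>e = - a / k\<close>.\<close>
    define \<alpha> where "\<alpha> = 1 - 1 / k"
    have N\<alpha>: "N * \<alpha> = 2 * m\<^sup>2 - N"
    proof -
      have "N * (1 / k) = 2 * E" using k0 by (simp add: kE[symmetric])
      then show ?thesis using NE by (simp add: \<alpha>_def algebra_simps)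
    qed
    have "\<alpha>\<^sup>2 * (norm a)\<^sup>2 + m\<^sup>2 = (norm a)\<^sup>2"
    proof -
      have "k * \<alpha> = k - 1" using k0 by (simp add: \<alpha>_def field_simps)
      moreover have "m\<^sup>2 = N - E" using NE by simp
      ultimately have "2 * k * (\<alpha>\<^sup>2 * (k * N / 2) + m\<^sup>2) = 2 * k * (k * N / 2)"
        using kE by (simp add: power2_eq_square) algebra
      then show ?thesis using k0 by (simp add: na)
    qed
    then have "positive_tangent_vector K (c + (\<alpha> *\<^sub>R a + m *\<^sub>R t))
        (\<alpha> *\<^sub>R t - (m / (norm a)\<^sup>2) *\<^sub>R a)" by (rule tan)
    moreover have "c + (\<alpha> *\<^sub>R a + m *\<^sub>R t) = y"
      using k0 by (simp add: c_def \<alpha>_def a_def e_def w_def algebra_simps)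
    moreover have "\<alpha> *\<^sub>R t - (m / (norm a)\<^sup>2) *\<^sub>R a = s"
    proof -
      have "(m / (norm a)\<^sup>2) *\<^sub>R a = - (2 * m / N) *\<^sub>R e" using k0 unfolding na by (simp add: a_def)
      then have "N *\<^sub>R (\<alpha> *\<^sub>R t - (m / (norm a)\<^sup>2) *\<^sub>R a) = (N * \<alpha>) *\<^sub>R t + (2 * m) *\<^sub>R e"
        using N0 by (simp add: algebra_simps)
      also have "\<dots> = (2 * m) *\<^sub>R w - N *\<^sub>R t"
        unfolding N\<alpha> e_def by (simp add: algebra_simps power2_eq_square)
      also have "\<dots> = N *\<^sub>R s" using s by (simp add: N_def power2_norm_eq_inner m_def w_def)
      finally show ?thesis using N0 by simp
    qed
    ultimately show ?thesis by simp
  qed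
  ultimately show thesis using that K by blast
qed

theorem lemma4p1:
  fixes T S :: "complex^4"
  assumes "T \<noteq> 0" and "S \<noteq> 0"
    and "cline T \<in> Q" and "cline S \<in> Q"
    and "twistor (cline T) \<noteq> twistor (cline S)"
  shows "(\<exists>K\<in>oriented_circles. positively_tangent (cline T) K \<and> positively_tangent (cline S) K)
    \<longleftrightarrow> Omega T S = 0"
proof -
  \<comment> \<open>Over a common base point the twistor images would coincide. The representations
    are arbitrary because one direction takes them from tangency and the other from membership in
    \<open>Q\<close>.\<close>
  have distinct: "x \<noteq> y"
    if "cline T = tangent_line_point x \<mu>" "cline S = tangent_line_point y \<nu>" for x y \<mu> \<nu>
    using assms that twistor_tangent_line_point mem_cline by metis
  show ?thesis
  proof
    assume "\<exists>K\<in>oriented_circles. positively_tangent (cline T) K \<and> positively_tangent (cline S) K"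
    then obtain K x \<mu> y \<nu> where K: "K \<in> oriented_circles"
      and x: "norm x = 1" "\<mu> \<in> qImag" "norm \<mu> = 1" "cline T = tangent_line_point x \<mu>"
        "positive_tangent_vector K x (x \<odot> \<mu>)"
      and y: "norm y = 1" "\<nu> \<in> qImag" "norm \<nu> = 1" "cline S = tangent_line_point y \<nu>"
        "positive_tangent_vector K y (y \<odot> \<nu>)"
      unfolding positively_tangent_def S3_def by auto
    have "(norm (y - x))\<^sup>2 *\<^sub>R (y \<odot> \<nu>)
      = (2 * ((x \<odot> \<mu>) \<bullet> (y - x))) *\<^sub>R (y - x) - (norm (y - x))\<^sup>2 *\<^sub>R (x \<odot> \<mu>)"
      using reflection_of_positive_tangent_vectors[of "fst K" "snd K"] K x y
      by (simp add: norm_qmult)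
    then show "Omega T S = 0"
      using Omega_tangent_line_points[of x y \<mu> T S \<nu>] x y distinct assms mem_cline by metis
  next
    assume "Omega T S = 0"
    obtain x \<mu> where x: "norm x = 1" "\<mu> \<in> qImag" "norm \<mu> = 1" "cline T = tangent_line_point x \<mu>"
      using Q_tangent_line_point assms by metis
    obtain y \<nu> where y: "norm y = 1" "\<nu> \<in> qImag" "norm \<nu> = 1" "cline S = tangent_line_point y \<nu>"
      using Q_tangent_line_point assms by metis
    have xy: "x \<noteq> y" using distinct x y by blast
    have "(norm (y - x))\<^sup>2 *\<^sub>R (y \<odot> \<nu>)
      = (2 * ((x \<odot> \<mu>) \<bullet> (y - x))) *\<^sub>R (y - x) - (norm (y - x))\<^sup>2 *\<^sub>R (x \<odot> \<mu>)"
      using Omega_tangent_line_points[of x y \<mu> T S \<nu>] x y xy assms mem_cline \<open>Omega T S = 0\<close>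
      by metis
    then obtain K where K: "K \<in> oriented_circles"
      "positive_tangent_vector K x (x \<odot> \<mu>)" "positive_tangent_vector K y (y \<odot> \<nu>)"
      using exists_circle_of_reflection[of x y "x \<odot> \<mu>" "y \<odot> \<nu>"] x y xy
      by (auto simp: inner_qmult_qImag norm_qmult)
    then show "\<exists>K\<in>oriented_circles. positively_tangent (cline T) K \<and> positively_tangent (cline S) K"
      using x y unfolding positively_tangent_def S3_def by (metis mem_sphere_0)
  qed
qed

end
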